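(* If $N$ is a closed ground (type $\iota$) $\beta$-normal auxiliary term, then $$h([\![N]\!]^\infty)\le2^{\rho(N)}.$$
   Context: Ordinals are classical with ordinary ordinal arithmetic and exponentiation; $\vee$ is binary supremum. **Dialogue trees and values.** Simple types: $\sigma,\tau::=\iota\mid\sigma\to\tau$. $\mathcal D(\mathbb N)$ is inductively generated by leaves $\eta(n)$ ($n\in\mathbb N$) and nodes $\beta_i(\varphi)$ ($i\in\mathbb N$, $\varphi:\mathbb N\to\mathcal D(\mathbb N)$). Height: $h(\eta(n))=0$, $h(\beta_i(\varphi))=\sup_{n\in\mathbb N}(h(\varphi(n))+1)$. Grafting, for $g:\mathbb N\to\mathcal D(\mathbb N)$: $\eta(n)\gg\!\!=g\;=\;g(n)$, $\beta_i(\varphi)\gg\!\!=g\;=\;\beta_i(n\mapsto\varphi(n)\gg\!\!=g)$. $V_\iota=\mathcal D(\mathbb N)$, $V_{\sigma\to\tau}=V_\sigma\to V_\tau$. A valuation $\gamma$ for $\Gamma$ assigns $\gamma(x)\in V_\sigma$ to each $x:\sigma$ in $\Gamma$. **Auxiliary (infinitary) terms.** Typed terms in contexts are inductively generated (well-founded, possibly countably branching), up to renaming of bound variables, by variables, abstraction, application with the usual typing, literals $\Gamma\vdash\underline n:\iota$ ($n\in\mathbb N$), queries $\Gamma\vdash\mathsf{query}_i(n\mapsto M_n):\iota$ ($i\in\mathbb N$, $\Gamma\vdash M_n:\iota$ for all $n$), and selections $\Gamma\vdash\mathsf{case}(M;\,n\mapsto M_n):\iota$ ($\Gamma\vdash M:\iota$,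 $\Gamma\vdash M_n:\iota$ for all $n$). Closed terms are terms in the empty context (the valuation is then omitted). A term is $\beta$-normal if it has no subterm of the form $(\lambda x^\sigma.U)\,V$ (including under abstractions and in every branch). Semantics $[\![M]\!]^\infty_\gamma\in V_\sigma$: $[\![x]\!]^\infty_\gamma=\gamma(x)$; $[\![\lambda x^\sigma.M]\!]^\infty_\gamma(a)=[\![M]\!]^\infty_{\gamma[x\mapsto a]}$; $[\![F\,V]\!]^\infty_\gamma=[\![F]\!]^\infty_\gamma([\![V]\!]^\infty_\gamma)$; $[\![\underline n]\!]^\infty_\gamma=\eta(n)$; $[\![\mathsf{query}_i(n\mapsto M_n)]\!]^\infty_\gamma=\beta_i(n\mapsto[\![M_n]\!]^\infty_\gamma)$; $[\![\mathsf{case}(M;n\mapsto M_n)]\!]^\infty_\gamma=[\![M]\!]^\infty_\gamma\gg\!\!=(n\mapsto[\![M_n]\!]^\infty_\gamma)$. **Rank.** $\rho(x)=\rho(\underline n)=0$; $\rho(\lambda x^\sigma.M)=\rho(M)+1$; $\rho(F\,V)=(\rho(F)\vee\rho(V))+1$; $\rho(\mathsf{query}_i(n\mapsto M_n))=(\sup_n\rho(M_n))+1$; $\rho(\mathsf{case}(M;n\mapsto M_n))=(\rho(M)\vee\sup_n\rho(M_n))+1$. *)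

theory Defs
  imports "HOL-Library.Countable_Set_Type"
begin

section \<open>Ordinals\<close>

text \<open>
  The ordinals are the elements of the canonical well-order of type \<open>\<omega>\<^sub>1\<close>, the cardinal successor
  of \<open>\<aleph>\<^sub>0\<close>, i.e. the countable ordinals. All trees and terms below branch at most countably, so
  their heights and ranks are countable, and suprema of countable families, sums, products and
  powers of countable ordinals are countable: nothing here leaves \<open>\<omega>\<^sub>1\<close>.
\<close>

typedef ordinal = "Field (cardSuc natLeq)"
proof -
  have "Field (cardSuc natLeq) \<noteq> {}"
    using cardSuc_finite[OF natLeq_Card_order] Field_natLeq by auto
  then show ?thesis by blast
qed

lemma Well_order_cardSuc_natLeq: "Well_order (cardSuc natLeq)"
  using cardSuc_Card_order[OF natLeq_Card_order] by (simp add: card_order_on_def)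

instantiation ordinal :: wellorder
begin

definition less_eq_ordinal :: "ordinal \<Rightarrow> ordinal \<Rightarrow> bool"
  where "\<alpha> \<le> \<beta> \<longleftrightarrow> (Rep_ordinal \<alpha>, Rep_ordinal \<beta>) \<in> cardSuc natLeq"

definition less_ordinal :: "ordinal \<Rightarrow> ordinal \<Rightarrow> bool"
  where "(\<alpha>::ordinal) < \<beta> \<longleftrightarrow> \<alpha> \<le> \<beta> \<and> \<not> \<beta> \<le> \<alpha>"

instance
proof
  note wo = Well_order_cardSuc_natLeq[unfolded well_order_on_def linear_order_on_def
      partial_order_on_def preorder_on_def]
  fix x y z :: ordinal
  show "x < y \<longleftrightarrow> x \<le> y \<and> \<not> y \<le> x" by (simp add: less_ordinal_def)
  show "x \<le> x"
    using wo Rep_ordinal[of x] by (auto simp: less_eq_ordinal_def refl_on_def)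
  show "x \<le> z" if "x \<le> y" "y \<le> z"
    using wo that unfolding less_eq_ordinal_def by (meson transD)
  show antisym: "x = y" if "x \<le> y" "y \<le> x" for x y :: ordinal
    using wo that unfolding less_eq_ordinal_def by (metis antisymD Rep_ordinal_inject)
  show total: "x \<le> y \<or> y \<le> x" for x y :: ordinal
  proof (cases "x = y")
    case True
    then show ?thesis
      using wo Rep_ordinal[of x] by (auto simp: less_eq_ordinal_def refl_on_def)
  next
    case False
    then have "Rep_ordinal x \<noteq> Rep_ordinal y" by (simp add: Rep_ordinal_inject)
    then show ?thesis
      using wo Rep_ordinal[of x] Rep_ordinal[of y]
      by (auto simp: less_eq_ordinal_def total_on_def)
  qed
  fix P :: "ordinal \<Rightarrow> bool" and a
  assume step: "\<And>x. (\<And>y. y < x \<Longrightarrow> P y) \<Longrightarrow> P x"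
  have "wf (inv_image (cardSuc natLeq - Id) Rep_ordinal)"
    using wo by (intro wf_inv_image) auto
  then show "P a"
  proof (induction a rule: wf_induct_rule)
    case (less x)
    show ?case
    proof (rule step)
      fix y assume "y < x"
      then have "(y, x) \<in> inv_image (cardSuc natLeq - Id) Rep_ordinal"
        by (auto simp: less_ordinal_def less_eq_ordinal_def)
      then show "P y" by (rule less)
    qed
  qed
qed

end

lemma countable_lessThan_ordinal:
  includes cardinal_syntax
  shows "countable {..<\<alpha>::ordinal}"
proof -
  let ?U = "underS (cardSuc natLeq) (Rep_ordinal \<alpha>)"
  have "|?U| <o cardSuc natLeq"
    by (rule card_of_underS[OF cardSuc_Card_order[OF natLeq_Card_order] Rep_ordinal])
  then have "|?U| \<le>o natLeq"
    using cardSuc_ordLeq_ordLess[OF natLeq_Card_order card_of_Card_order] by blast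
  then have "countable ?U" by (simp add: countable_card_le_natLeq)
  moreover have "Rep_ordinal ` {..<\<alpha>} \<subseteq> ?U"
    by (auto simp: underS_def less_eq_ordinal_def less_ordinal_def)
  ultimately have "countable (Rep_ordinal ` {..<\<alpha>})" by (rule countable_subset[rotated])
  then show ?thesis
    by (rule countable_image_inj_on) (simp add: inj_on_def Rep_ordinal_inject)
qed

lemma uncountable_UNIV_ordinal:
  includes cardinal_syntax
  shows "\<not> countable (UNIV :: ordinal set)"
proof
  assume "countable (UNIV :: ordinal set)"
  then have "countable (range Rep_ordinal)" by simp
  moreover have "range Rep_ordinal = Field (cardSuc natLeq)"
    by (rule type_definition.Rep_range[OF type_definition_ordinal])
  ultimately have "|Field (cardSuc natLeq)| \<le>o natLeq"
    by (simp add: countable_card_le_natLeq)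
  then have "cardSuc natLeq \<le>o natLeq"
    using card_of_Field_ordIso[OF cardSuc_Card_order[OF natLeq_Card_order]]
    by (meson ordIso_ordLeq_trans ordIso_symmetric)
  then show False
    using cardSuc_greater[OF natLeq_Card_order] not_ordLess_ordLeq by blast
qed

lemma countable_strict_bound_ordinal:
  assumes "countable A"
  shows "\<exists>\<beta>. \<forall>\<alpha>\<in>A. \<alpha> < (\<beta>::ordinal)"
proof (rule ccontr)
  assume "\<not> ?thesis"
  then have "(\<Union>\<alpha>\<in>A. insert \<alpha> {..<\<alpha>}) = UNIV"
    by (auto simp: not_less) (metis order_le_less)
  moreover have "countable (\<Union>\<alpha>\<in>A. insert \<alpha> {..<\<alpha>})"
    using assms countable_lessThan_ordinal by auto
  ultimately show False using uncountable_UNIV_ordinal by simp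
qed

lemma countable_bdd_above_ordinal: "countable A \<Longrightarrow> bdd_above (A :: ordinal set)"
  using countable_strict_bound_ordinal unfolding bdd_above_def by (meson less_imp_le)

instantiation ordinal :: conditionally_complete_linorder
begin

definition inf_ordinal :: "ordinal \<Rightarrow> ordinal \<Rightarrow> ordinal" where "inf_ordinal = min"
definition sup_ordinal :: "ordinal \<Rightarrow> ordinal \<Rightarrow> ordinal" where "sup_ordinal = max"
definition Inf_ordinal :: "ordinal set \<Rightarrow> ordinal" where "Inf (A :: ordinal set) = (LEAST \<alpha>. \<alpha> \<in> A)"
definition Sup_ordinal :: "ordinal set \<Rightarrow> ordinal" where "Sup (A :: ordinal set) = (LEAST \<beta>. \<forall>\<alpha>\<in>A. \<alpha> \<le> \<beta>)"

instance
proof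
  fix x y z :: ordinal and A :: "ordinal set"
  show "inf x y \<le> x" "inf x y \<le> y" "x \<le> sup x y" "y \<le> sup x y"
    by (simp_all add: inf_ordinal_def sup_ordinal_def)
  show "x \<le> inf y z" if "x \<le> y" "x \<le> z" using that by (simp add: inf_ordinal_def)
  show "sup y z \<le> x" if "y \<le> x" "z \<le> x" using that by (simp add: sup_ordinal_def)
  show "Inf A \<le> x" if "x \<in> A" "bdd_below A" using that by (simp add: Inf_ordinal_def Least_le)
  show "x \<le> Inf A" if "A \<noteq> {}" "\<And>y. y \<in> A \<Longrightarrow> x \<le> y"
    using that unfolding Inf_ordinal_def ex_in_conv[symmetric] by (rule LeastI2_ex)
  show "x \<le> Sup A" if "x \<in> A" "bdd_above A"
  proof -
    have "\<exists>\<beta>. \<forall>\<alpha>\<in>A. \<alpha> \<le> \<beta>" using that by (auto simp: bdd_above_def)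
    then have "\<forall>\<alpha>\<in>A. \<alpha> \<le> Sup A" unfolding Sup_ordinal_def by (rule LeastI_ex)
    with that show ?thesis by blast
  qed
  show "Sup A \<le> x" if "A \<noteq> {}" "\<And>y. y \<in> A \<Longrightarrow> y \<le> x"
    using that by (simp add: Sup_ordinal_def Least_le)
qed

end

lemma le_SUP_ordinal: "f n \<le> (SUP n. f n)" for f :: "nat \<Rightarrow> ordinal"
  by (intro cSUP_upper countable_bdd_above_ordinal) simp_all

subsection \<open>Arithmetic\<close>

definition osuc :: "ordinal \<Rightarrow> ordinal"
  where "osuc \<alpha> = (LEAST \<beta>. \<alpha> < \<beta>)"

lemma less_osuc: "\<alpha> < osuc \<alpha>"
  unfolding osuc_def
  using countable_strict_bound_ordinal[of "{\<alpha>}"] by (auto intro: LeastI_ex)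

lemma osuc_le_iff: "osuc \<alpha> \<le> \<beta> \<longleftrightarrow> \<alpha> < \<beta>"
  using less_osuc[of \<alpha>] by (auto simp: osuc_def intro: Least_le)

lemma less_osuc_iff: "\<alpha> < osuc \<beta> \<longleftrightarrow> \<alpha> \<le> \<beta>"
  using osuc_le_iff not_less by blast

lemma osuc_inject: "osuc \<alpha> = osuc \<beta> \<longleftrightarrow> \<alpha> = \<beta>"
  by (metis less_osuc_iff antisym order_refl)

instantiation ordinal :: zero_neq_one
begin

definition zero_ordinal :: ordinal where "(0::ordinal) = (LEAST \<alpha>. True)"
definition one_ordinal :: ordinal where "(1::ordinal) = osuc 0"

instance
  by standard (metis less_osuc one_ordinal_def order_less_irrefl)

end

lemma zero_le_ordinal [simp]: "0 \<le> (\<alpha>::ordinal)"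
  by (simp add: zero_ordinal_def Least_le)

definition is_limit :: "ordinal \<Rightarrow> bool"
  where "is_limit \<delta> \<longleftrightarrow> \<delta> \<noteq> 0 \<and> (\<forall>\<alpha>. \<delta> \<noteq> osuc \<alpha>)"

text \<open>
  Transfinite recursion in the format of ordinal arithmetic: a value at 0, a step at
  successors, and suprema at limits.
\<close>

function orec :: "ordinal \<Rightarrow> (ordinal \<Rightarrow> ordinal) \<Rightarrow> ordinal \<Rightarrow> ordinal" where
  "orec z s 0 = z"
| "orec z s (osuc \<beta>) = s (orec z s \<beta>)"
| "is_limit \<delta> \<Longrightarrow> orec z s \<delta> = (SUP \<beta>\<in>{0<..<\<delta>}. orec z s \<beta>)"
  subgoal for P x
    by (cases x) (metis is_limit_def)
  by (auto simp: is_limit_def osuc_inject) (metis less_osuc leD zero_le_ordinal)+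
termination
  by (relation "{(x, y). snd (snd x) < snd (snd y)}")
    (auto simp: less_osuc intro: wf_inv_image[OF wf, of "\<lambda>x. snd (snd x)", unfolded inv_image_def, simplified])

instantiation ordinal :: "{plus, times}"
begin

definition plus_ordinal :: "ordinal \<Rightarrow> ordinal \<Rightarrow> ordinal" where "(\<alpha>::ordinal) + \<beta> = orec \<alpha> osuc \<beta>"
definition times_ordinal :: "ordinal \<Rightarrow> ordinal \<Rightarrow> ordinal" where "(\<alpha>::ordinal) * \<beta> = orec 0 (\<lambda>\<xi>. \<xi> + \<alpha>) \<beta>"

instance ..

end

definition opow :: "ordinal \<Rightarrow> ordinal \<Rightarrow> ordinal"  (infixr "^\<^sub>o" 80)
  where "\<alpha> ^\<^sub>o \<beta> = orec 1 (\<lambda>\<xi>. \<xi> * \<alpha>) \<beta>"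

lemma plus_one_ordinal: "\<alpha> + 1 = osuc \<alpha>"
  by (simp add: plus_ordinal_def one_ordinal_def)

lemma plus_ordinal_simps:
  fixes \<alpha> :: ordinal
  shows "\<alpha> + 0 = \<alpha>"
    and "\<alpha> + osuc \<beta> = osuc (\<alpha> + \<beta>)"
    and "is_limit \<delta> \<Longrightarrow> \<alpha> + \<delta> = (SUP \<beta>\<in>{0<..<\<delta>}. \<alpha> + \<beta>)"
  by (simp_all add: plus_ordinal_def)

lemma times_ordinal_simps:
  fixes \<alpha> :: ordinal
  shows "\<alpha> * 0 = 0"
    and "\<alpha> * (\<beta> + 1) = \<alpha> * \<beta> + \<alpha>"
    and "is_limit \<delta> \<Longrightarrow> \<alpha> * \<delta> = (SUP \<beta>\<in>{0<..<\<delta>}. \<alpha> * \<beta>)"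
  by (simp_all add: times_ordinal_def plus_one_ordinal)

lemma opow_simps:
  "\<alpha> ^\<^sub>o 0 = 1"
  "\<alpha> ^\<^sub>o (\<beta> + 1) = \<alpha> ^\<^sub>o \<beta> * \<alpha>"
  "is_limit \<delta> \<Longrightarrow> \<alpha> ^\<^sub>o \<delta> = (SUP \<beta>\<in>{0<..<\<delta>}. \<alpha> ^\<^sub>o \<beta>)"
  by (simp_all add: opow_def plus_one_ordinal)


section \<open>Dialogue trees\<close>

datatype dialogue = Leaf nat | Node nat "nat \<Rightarrow> dialogue"

primrec height :: "dialogue \<Rightarrow> ordinal" where
  "height (Leaf n) = 0"
| "height (Node i \<phi>) = (SUP n. height (\<phi> n) + 1)"

primrec graft :: "dialogue \<Rightarrow> (nat \<Rightarrow> dialogue) \<Rightarrow> dialogue" where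
  "graft (Leaf n) g = g n"
| "graft (Node i \<phi>) g = Node i (\<lambda>n. graft (\<phi> n) g)"

section \<open>Types and infinitary terms\<close>

datatype ty = Iota  ("\<iota>") | Arrow ty ty  (infixr "\<rightarrow>\<^sub>t" 60)

text \<open>
  Terms are in de Bruijn notation, which identifies them up to renaming of bound variables.
  A context is the list of the types of the free variables, innermost first.
\<close>

datatype trm =
    Var nat
  | Lam ty trm
  | App trm trm
  | Lit nat
  | Query nat "nat \<Rightarrow> trm"
  | Case trm "nat \<Rightarrow> trm"

inductive typed :: "ty list \<Rightarrow> trm \<Rightarrow> ty \<Rightarrow> bool"  ("_ \<turnstile> _ \<Colon> _" [51, 51, 51] 50) where
  Var: "n < length \<Gamma> \<Longrightarrow> \<Gamma> \<turnstile> Var n \<Colon> \<Gamma> ! n"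
| Lam: "\<sigma> # \<Gamma> \<turnstile> M \<Colon> \<tau> \<Longrightarrow> \<Gamma> \<turnstile> Lam \<sigma> M \<Colon> \<sigma> \<rightarrow>\<^sub>t \<tau>"
| App: "\<Gamma> \<turnstile> F \<Colon> \<sigma> \<rightarrow>\<^sub>t \<tau> \<Longrightarrow> \<Gamma> \<turnstile> V \<Colon> \<sigma> \<Longrightarrow> \<Gamma> \<turnstile> App F V \<Colon> \<tau>"
| Lit: "\<Gamma> \<turnstile> Lit n \<Colon> \<iota>"
| Query: "(\<And>n. \<Gamma> \<turnstile> Ms n \<Colon> \<iota>) \<Longrightarrow> \<Gamma> \<turnstile> Query i Ms \<Colon> \<iota>"
| Case: "\<Gamma> \<turnstile> M \<Colon> \<iota> \<Longrightarrow> (\<And>n. \<Gamma> \<turnstile> Ms n \<Colon> \<iota>) \<Longrightarrow> \<Gamma> \<turnstile> Case M Ms \<Colon> \<iota>"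

text \<open>
  \<open>subterm \<Gamma> M \<Delta> K\<close>: the term \<open>M\<close> in context \<open>\<Gamma>\<close> has the subterm \<open>K\<close>, occurring in context \<open>\<Delta>\<close>.
\<close>

inductive subterm :: "ty list \<Rightarrow> trm \<Rightarrow> ty list \<Rightarrow> trm \<Rightarrow> bool" where
  self: "subterm \<Gamma> M \<Gamma> M"
| lam: "subterm (\<sigma> # \<Gamma>) M \<Delta> K \<Longrightarrow> subterm \<Gamma> (Lam \<sigma> M) \<Delta> K"
| fun_part: "subterm \<Gamma> F \<Delta> K \<Longrightarrow> subterm \<Gamma> (App F V) \<Delta> K"
| arg_part: "subterm \<Gamma> V \<Delta> K \<Longrightarrow> subterm \<Gamma> (App F V) \<Delta> K"
| query: "subterm \<Gamma> (Ms n) \<Delta> K \<Longrightarrow> subterm \<Gamma> (Query i Ms) \<Delta> K"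
| scrutinee: "subterm \<Gamma> M \<Delta> K \<Longrightarrow> subterm \<Gamma> (Case M Ms) \<Delta> K"
| branch: "subterm \<Gamma> (Ms n) \<Delta> K \<Longrightarrow> subterm \<Gamma> (Case M Ms) \<Delta> K"

definition beta_normal :: "ty list \<Rightarrow> trm \<Rightarrow> bool"
  where "beta_normal \<Gamma> M \<longleftrightarrow> \<not> (\<exists>\<Delta> \<sigma> U V. subterm \<Gamma> M \<Delta> (App (Lam \<sigma> U) V))"

primrec rank :: "trm \<Rightarrow> ordinal" where
  "rank (Var n) = 0"
| "rank (Lam \<sigma> M) = rank M + 1"
| "rank (App F V) = max (rank F) (rank V) + 1"
| "rank (Lit n) = 0"
| "rank (Query i Ms) = (SUP n. rank (Ms n)) + 1"
| "rank (Case M Ms) = max (rank M) (SUP n. rank (Ms n)) + 1"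

section \<open>Semantics\<close>

text \<open>
  The full type hierarchy \<open>V\<^sub>\<sigma>\<close> is indexed by the simple types, and no single HOL type provably
  contains all of it. Its members are therefore represented in a universe \<open>'u val\<close> over an
  arbitrary type \<open>'u\<close> of codes for functions: \<open>code\<close> assigns a code to (the graph of) a function
  between sets of values, and \<open>decode\<close> recovers the function.
\<close>

datatype 'u val = Ground (ground: dialogue) | Func (func: 'u)

type_synonym 'u graph = "'u val \<rightharpoonup> 'u val"

definition graphs :: "'u val set \<Rightarrow> 'u val set \<Rightarrow> 'u graph set"
  where "graphs A B = {f. dom f = A \<and> ran f \<subseteq> B}"

primrec vals :: "('u graph \<Rightarrow> 'u) \<Rightarrow> ty \<Rightarrow> 'u val set" where
  "vals code \<iota> = range Ground"
| "vals code (\<sigma> \<rightarrow>\<^sub>t \<tau>) = (\<lambda>f. Func (code f)) ` graphs (vals code \<sigma>) (vals code \<tau>)"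

primrec components :: "ty \<Rightarrow> ty set" where
  "components \<iota> = {\<iota>}"
| "components (\<sigma> \<rightarrow>\<^sub>t \<tau>) = insert (\<sigma> \<rightarrow>\<^sub>t \<tau>) (components \<sigma> \<union> components \<tau>)"

definition types_in :: "ty list \<Rightarrow> trm \<Rightarrow> ty set"
  where "types_in \<Gamma> M = {\<tau>. \<exists>\<Delta> K \<sigma>. subterm \<Gamma> M \<Delta> K \<and> \<Delta> \<turnstile> K \<Colon> \<sigma> \<and> \<tau> \<in> components \<sigma>}"

text \<open>
  For a set \<open>T\<close> of types closed under components, the following says that \<open>vals code \<sigma>\<close> is, for
  each \<open>\<sigma> \<in> T\<close>, a faithful copy of \<open>V\<^sub>\<sigma>\<close>: distinct functions \<open>V\<^sub>\<sigma> \<rightarrow> V\<^sub>\<tau>\<close> have distinct codes, and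
  application of codes is application of functions.
  It is a condition on the representation only. It constrains nothing when \<open>T = {\<iota>}\<close>, and
  \<open>full_hierarchy_extend\<close> below shows that iterating a construction on the type \<open>'u\<close> reaches
  every finite set of types.
\<close>

definition full_hierarchy :: "('u graph \<Rightarrow> 'u) \<Rightarrow> ('u \<Rightarrow> 'u graph) \<Rightarrow> ty set \<Rightarrow> bool"
  where "full_hierarchy code decode T \<longleftrightarrow>
    (\<forall>\<sigma> \<tau>. \<sigma> \<rightarrow>\<^sub>t \<tau> \<in> T \<longrightarrow>
      (\<forall>f \<in> graphs (vals code \<sigma>) (vals code \<tau>). decode (code f) = f))"

text \<open>A valuation is the list of the values of the free variables, innermost first.\<close>

primrec sem :: "('u graph \<Rightarrow> 'u) \<Rightarrow> ('u \<Rightarrow> 'u graph) \<Rightarrow> trm \<Rightarrow> 'u val list \<Rightarrow> 'u val" where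
  "sem code decode (Var n) \<gamma> = \<gamma> ! n"
| "sem code decode (Lam \<sigma> M) \<gamma> =
    Func (code (\<lambda>a. if a \<in> vals code \<sigma> then Some (sem code decode M (a # \<gamma>)) else None))"
| "sem code decode (App F V) \<gamma> =
    the (decode (func (sem code decode F \<gamma>)) (sem code decode V \<gamma>))"
| "sem code decode (Lit n) \<gamma> = Ground (Leaf n)"
| "sem code decode (Query i Ms) \<gamma> =
    Ground (Node i (\<lambda>n. ground (sem code decode (Ms n) \<gamma>)))"
| "sem code decode (Case M Ms) \<gamma> =
    Ground (graft (ground (sem code decode M \<gamma>)) (\<lambda>n. ground (sem code decode (Ms n) \<gamma>)))"

subsection \<open>Adequacy of the representation\<close>

lemma components_self: "\<sigma> \<in> components \<sigma>"
  by (cases \<sigma>) auto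

lemma components_trans: "\<tau> \<in> components \<sigma> \<Longrightarrow> components \<tau> \<subseteq> components \<sigma>"
  by (induction \<sigma>) auto

lemma types_in_self: "\<Gamma> \<turnstile> M \<Colon> \<sigma> \<Longrightarrow> \<sigma> \<in> types_in \<Gamma> M"
  by (auto simp: types_in_def intro: components_self subterm.self)

lemma types_in_mono:
  assumes "\<And>\<Delta> K. subterm \<Gamma>' M' \<Delta> K \<Longrightarrow> subterm \<Gamma> M \<Delta> K"
  shows "types_in \<Gamma>' M' \<subseteq> types_in \<Gamma> M"
  using assms by (auto simp: types_in_def)

lemma full_hierarchy_mono: "full_hierarchy code decode T \<Longrightarrow> T' \<subseteq> T \<Longrightarrow> full_hierarchy code decode T'"
  unfolding full_hierarchy_def by blast

lemma full_hierarchy_ground: "full_hierarchy code decode {\<iota>}"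
  by (simp add: full_hierarchy_def)

lemma sem_in_vals:
  assumes "\<Gamma> \<turnstile> M \<Colon> \<sigma>" and "full_hierarchy code decode (types_in \<Gamma> M)"
    and "list_all2 (\<lambda>a \<rho>. a \<in> vals code \<rho>) \<gamma> \<Gamma>"
  shows "sem code decode M \<gamma> \<in> vals code \<sigma>"
  using assms
proof (induction arbitrary: \<gamma>)
  case (Var n \<Gamma>)
  then show ?case by (simp add: list_all2_conv_all_nth)
next
  case (Lam \<sigma> \<Gamma> M \<tau>)
  have "full_hierarchy code decode (types_in (\<sigma> # \<Gamma>) M)"
    by (rule full_hierarchy_mono[OF Lam.prems(1)]) (intro types_in_mono subterm.lam)
  then have "sem code decode M (a # \<gamma>) \<in> vals code \<tau>" if "a \<in> vals code \<sigma>" for a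
    using Lam.IH Lam.prems(2) that by simp
  then show ?case
    by (auto simp: graphs_def dom_def ran_def intro!: imageI split: if_splits)
next
  case (App \<Gamma> F \<sigma> \<tau> W)
  have sub: "types_in \<Gamma> F \<subseteq> types_in \<Gamma> (App F W)" "types_in \<Gamma> W \<subseteq> types_in \<Gamma> (App F W)"
    by (intro types_in_mono; erule subterm.fun_part subterm.arg_part)+
  have F: "sem code decode F \<gamma> \<in> vals code (\<sigma> \<rightarrow>\<^sub>t \<tau>)"
    and W: "sem code decode W \<gamma> \<in> vals code \<sigma>"
    using App.IH App.prems full_hierarchy_mono sub by blast+
  have "\<sigma> \<rightarrow>\<^sub>t \<tau> \<in> types_in \<Gamma> (App F W)"
    using types_in_self[OF App.hyps(1)] sub by blast
  with F obtain f where f: "f \<in> graphs (vals code \<sigma>) (vals code \<tau>)"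
    and "func (sem code decode F \<gamma>) = code f" and "decode (code f) = f"
    using App.prems(1) by (auto simp: full_hierarchy_def)
  moreover obtain b where "f (sem code decode W \<gamma>) = Some b"
    using f W by (auto simp: graphs_def)
  ultimately show ?case
    using f by (auto simp: graphs_def intro: ranI)
qed simp_all

lemma sem_beta:
  assumes "\<Gamma> \<turnstile> Lam \<sigma> M \<Colon> \<sigma> \<rightarrow>\<^sub>t \<tau>" and "full_hierarchy code decode (types_in \<Gamma> (Lam \<sigma> M))"
    and "list_all2 (\<lambda>a \<rho>. a \<in> vals code \<rho>) \<gamma> \<Gamma>" and "a \<in> vals code \<sigma>"
  shows "the (decode (func (sem code decode (Lam \<sigma> M) \<gamma>)) a) = sem code decode M (a # \<gamma>)"
proof -
  let ?f = "\<lambda>a. if a \<in> vals code \<sigma> then Some (sem code decode M (a # \<gamma>)) else None"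
  have M: "\<sigma> # \<Gamma> \<turnstile> M \<Colon> \<tau>"
    using assms(1) by (auto elim: typed.cases)
  have "full_hierarchy code decode (types_in (\<sigma> # \<Gamma>) M)"
    by (rule full_hierarchy_mono[OF assms(2)]) (intro types_in_mono subterm.lam)
  then have "?f \<in> graphs (vals code \<sigma>) (vals code \<tau>)"
    using sem_in_vals[OF M] assms(3)
    by (auto simp: graphs_def dom_def ran_def split: if_splits)
  then have "decode (code ?f) = ?f"
    using assms(2) types_in_self[OF assms(1)] unfolding full_hierarchy_def by blast
  then show ?thesis using assms(4) by simp
qed

lemma full_hierarchy_extend:
  fixes code :: "'u graph \<Rightarrow> 'u" and decode :: "'u \<Rightarrow> 'u graph"
  assumes full: "full_hierarchy code decode T"
    and closed: "\<And>\<sigma>. \<sigma> \<in> T \<Longrightarrow> components \<sigma> \<subseteq> T"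
  shows "\<exists>(code' :: ('u + 'u graph) graph \<Rightarrow> 'u + 'u graph) decode'.
    full_hierarchy code' decode' (T \<union> {\<sigma> \<rightarrow>\<^sub>t \<tau> | \<sigma> \<tau>. \<sigma> \<in> T \<and> \<tau> \<in> T})"
proof -
  define e :: "'u val \<Rightarrow> ('u + 'u graph) val"
    where "e v = (case v of Ground d \<Rightarrow> Ground d | Func u \<Rightarrow> Func (Inl u))" for v
  have inj: "inj e" by (auto simp: inj_def e_def split: val.splits)
  define emb :: "'u graph \<Rightarrow> ('u + 'u graph) graph"
    where "emb f = (\<lambda>x. if x \<in> range e then map_option e (f (inv e x)) else None)" for f
  define pull :: "('u + 'u graph) graph \<Rightarrow> 'u graph"
    where "pull g = (\<lambda>a. map_option (inv e) (g (e a)))" for g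
  define code' where "code' g =
    (let f = pull g in if decode (code f) = f then Inl (code f) else Inr f)" for g
  define decode' where "decode' u = (case u of Inl u \<Rightarrow> emb (decode u) | Inr f \<Rightarrow> emb f)" for u
  have pull_emb: "pull (emb f) = f" for f
    using inj by (auto simp: pull_def emb_def fun_eq_iff option.map_comp comp_def option.map_ident)
  have emb_pull: "emb (pull g) = g" if "dom g \<subseteq> range e" "ran g \<subseteq> range e" for g
  proof
    fix x
    show "emb (pull g) x = g x"
    proof (cases "g x")
      case None
      then show ?thesis by (auto simp: emb_def pull_def inj)
    next
      case (Some y)
      then have "x \<in> range e" "y \<in> range e" using that by (auto intro: ranI)
      then show ?thesis using Some by (auto simp: emb_def pull_def inj)
    qed
  qed
  have graphs_emb: "graphs (e ` A) (e ` B) = emb ` graphs A B" for A B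
  proof (intro equalityI subsetI)
    fix g assume g: "g \<in> graphs (e ` A) (e ` B)"
    then have "g = emb (pull g)"
      by (intro emb_pull[symmetric]) (auto simp: graphs_def)
    moreover have "pull g \<in> graphs A B"
    proof -
      have "dom (pull g) = A"
        using g inj by (auto simp: graphs_def pull_def dom_def inj_def set_eq_iff)
      moreover have "ran (pull g) \<subseteq> B"
        using g inj by (auto simp: graphs_def pull_def ran_def)
      ultimately show ?thesis by (simp add: graphs_def)
    qed
    ultimately show "g \<in> emb ` graphs A B" by blast
  next
    fix g assume "g \<in> emb ` graphs A B"
    then obtain f where f: "dom f = A" "ran f \<subseteq> B" and g: "g = emb f"
      by (auto simp: graphs_def)
    have "dom g = e ` dom f"
      using inj unfolding g emb_def dom_def by (auto simp: inj_eq)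
    moreover have "ran g \<subseteq> e ` ran f"
    proof
      fix y assume "y \<in> ran g"
      then obtain x where "g x = Some y" by (auto simp: ran_def)
      then show "y \<in> e ` ran f"
        unfolding g emb_def by (auto split: if_splits intro: ranI)
    qed
    ultimately show "g \<in> graphs (e ` A) (e ` B)"
      using f image_mono[OF f(2), of e] by (simp add: graphs_def)
  qed
  have vals': "vals code' \<sigma> = e ` vals code \<sigma>" if "\<sigma> \<in> T" for \<sigma>
    using that
  proof (induction \<sigma>)
    case Iota
    show ?case by (auto simp: e_def image_iff)
  next
    case (Arrow \<sigma> \<tau>)
    have "\<sigma> \<in> T" "\<tau> \<in> T" using closed[OF Arrow.prems] components_self by auto
    then have "vals code' (\<sigma> \<rightarrow>\<^sub>t \<tau>)
        = (\<lambda>f. Func (code' (emb f))) ` graphs (vals code \<sigma>) (vals code \<tau>)"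
      using Arrow.IH by (simp add: graphs_emb image_image)
    also have "\<dots> = (\<lambda>f. e (Func (code f))) ` graphs (vals code \<sigma>) (vals code \<tau>)"
      using full Arrow.prems
      by (intro image_cong) (auto simp: code'_def pull_emb full_hierarchy_def e_def)
    finally show ?case by (simp add: image_image)
  qed
  have "decode' (code' g) = g"
    if "\<sigma> \<in> T" "\<tau> \<in> T" "g \<in> graphs (vals code' \<sigma>) (vals code' \<tau>)" for \<sigma> \<tau> g
  proof -
    have "emb (pull g) = g"
      using that by (intro emb_pull) (auto simp: graphs_def vals')
    then show ?thesis by (simp add: code'_def decode'_def Let_def)
  qed
  moreover have "\<sigma> \<in> T \<and> \<tau> \<in> T" if "\<sigma> \<rightarrow>\<^sub>t \<tau> \<in> T" for \<sigma> \<tau>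
    using closed[OF that] components_self by auto
  ultimately have "full_hierarchy code' decode' (T \<union> {\<sigma> \<rightarrow>\<^sub>t \<tau> | \<sigma> \<tau>. \<sigma> \<in> T \<and> \<tau> \<in> T})"
    unfolding full_hierarchy_def by blast
  then show ?thesis by blast
qed

end

theory Submission
  imports Defs
begin

text \<open>
  A closed \<open>\<beta>\<close>-normal term is never an application: following function parts leads either to a
  variable, which is impossible in the empty context, or to a redex. A closed ground normal term is
  therefore built from literals, queries and selections only, and all its immediate subterms are of
  the same kind. Grafting satisfies \<open>h(d \<ggreater>= g) \<le> sup\<^sub>n h(g n) + h(d)\<close>, so
  each such step at most doubles the bound for the subterms.
\<close>

section \<open>Ordinal arithmetic\<close>

lemma ordinal_induct [case_names zero osuc limit]:
  fixes \<alpha> :: ordinal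
  assumes "P 0"
    and "\<And>\<beta>. P \<beta> \<Longrightarrow> P (osuc \<beta>)"
    and "\<And>\<delta>. is_limit \<delta> \<Longrightarrow> (\<And>\<beta>. \<beta> < \<delta> \<Longrightarrow> P \<beta>) \<Longrightarrow> P \<delta>"
  shows "P \<alpha>"
proof (induction \<alpha> rule: less_induct)
  case (less \<alpha>)
  then show ?case
    using assms by (metis is_limit_def less_osuc)
qed

lemma osuc_mono: "\<alpha> \<le> \<beta> \<Longrightarrow> osuc \<alpha> \<le> osuc \<beta>"
  by (simp add: osuc_le_iff less_osuc_iff)

lemma is_limit_osuc_less: "is_limit \<delta> \<Longrightarrow> \<beta> < \<delta> \<Longrightarrow> osuc \<beta> < \<delta>"
  by (metis is_limit_def osuc_le_iff order_le_less)

lemma osuc_pos: "0 < osuc \<alpha>"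
  using less_osuc zero_le_ordinal by (rule order_le_less_trans[rotated])

lemma is_limit_interval_nonempty: "is_limit \<delta> \<Longrightarrow> {0<..<\<delta>} \<noteq> {}"
  using is_limit_osuc_less[of \<delta> 0] osuc_pos[of 0]
  by (metis is_limit_def empty_iff greaterThanLessThan_iff order_le_less zero_le_ordinal)

text \<open>The interval is countable, hence so is its image, and countable sets of ordinals are
  bounded above.\<close>

lemma le_SUP_interval_ordinal:
  fixes f :: "ordinal \<Rightarrow> ordinal"
  assumes "0 < \<beta>" "\<beta> < \<delta>"
  shows "f \<beta> \<le> (SUP \<beta>\<in>{0<..<\<delta>}. f \<beta>)"
proof (rule cSUP_upper)
  have "countable {0<..<\<delta>}"
    by (rule countable_subset[OF _ countable_lessThan_ordinal[of \<delta>]]) auto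
  then show "bdd_above (f ` {0<..<\<delta>})"
    by (intro countable_bdd_above_ordinal) simp
qed (use assms in simp)

text \<open>A recursion whose step never decreases its argument is monotone. This one induction
  serves both addition and powers of 2.\<close>

lemma orec_mono:
  assumes inflate: "\<And>\<xi>. \<xi> \<le> s \<xi>" and "\<beta> \<le> \<gamma>"
  shows "orec z s \<beta> \<le> orec z s \<gamma>"
  using \<open>\<beta> \<le> \<gamma>\<close>
proof (induction \<gamma> arbitrary: \<beta> rule: ordinal_induct)
  case zero
  then show ?case using antisym[OF _ zero_le_ordinal] by blast
next
  case (osuc \<gamma>)
  show ?case
  proof (cases "\<beta> = osuc \<gamma>")
    case False
    then have "\<beta> \<le> \<gamma>" using osuc.prems by (metis less_osuc_iff order_le_less)
    then show ?thesis using osuc.IH inflate order_trans by fastforce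
  qed simp
next
  case (limit \<delta>)
  show ?case
  proof (cases "\<beta> = \<delta>")
    case False
    have "\<beta> < \<delta>" using False limit.prems by simp
    then have less: "osuc \<beta> < \<delta>" by (rule is_limit_osuc_less[OF limit.hyps])
    \<comment> \<open>The supremum at a limit omits the index 0, so \<open>\<beta>\<close> itself
      may be missing from it; its successor is positive and still below
      \<open>\<delta>\<close>.\<close>
    have "orec z s \<beta> \<le> orec z s (osuc \<beta>)" using inflate by simp
    also have "\<dots> \<le> orec z s \<delta>"
      unfolding orec.simps(3)[OF limit.hyps] by (rule le_SUP_interval_ordinal[OF osuc_pos less])
    finally show ?thesis .
  qed simp
qed

lemma plus_ordinal_mono_right: "\<beta> \<le> \<gamma> \<Longrightarrow> \<alpha> + \<beta> \<le> \<alpha> + \<gamma>" for \<alpha> :: ordinal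
  unfolding plus_ordinal_def by (rule orec_mono) (simp_all add: less_osuc less_imp_le)

lemma plus_ordinal_mono_left: "\<alpha> \<le> \<beta> \<Longrightarrow> \<alpha> + \<gamma> \<le> \<beta> + \<gamma>" for \<alpha> :: ordinal
proof (induction \<gamma> rule: ordinal_induct)
  case (limit \<delta>)
  have "\<alpha> + \<xi> \<le> (SUP \<xi>\<in>{0<..<\<delta>}. \<beta> + \<xi>)" if "\<xi> \<in> {0<..<\<delta>}" for \<xi>
    using that limit le_SUP_interval_ordinal[of \<xi> \<delta> "(+) \<beta>"] by (force intro: order_trans)
  then show ?case
    unfolding plus_ordinal_simps(3)[OF limit.hyps]
    by (rule cSUP_least[OF is_limit_interval_nonempty[OF limit.hyps]])
qed (simp_all add: plus_ordinal_simps osuc_mono)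

lemma zero_plus_ordinal: "0 + \<alpha> = (\<alpha> :: ordinal)"
proof (induction \<alpha> rule: ordinal_induct)
  case (limit \<delta>)
  let ?S = "SUP \<xi>\<in>{0<..<\<delta>}. \<xi>"
  have "?S \<le> \<delta>"
    using is_limit_interval_nonempty[OF limit.hyps] by (intro cSUP_least) auto
  \<comment> \<open>If \<open>?S\<close> were below the limit, so would be \<open>osuc ?S\<close>,
    which would then be one of the ordinals bounded by \<open>?S\<close>.\<close>
  moreover have "\<not> ?S < \<delta>"
    using is_limit_osuc_less[OF limit.hyps] le_SUP_interval_ordinal[OF osuc_pos, of ?S \<delta> "\<lambda>\<xi>. \<xi>"]
      less_osuc leD by blast
  moreover have "0 + \<delta> = ?S"
    using limit by (simp add: plus_ordinal_simps)
  ultimately show ?case by simp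
qed (simp_all add: plus_ordinal_simps)

text \<open>The recursion on the right factor yields \<open>(0 + \<alpha>) + \<alpha>\<close>, so
  the left unit law is what finishes.\<close>

lemma times_two_ordinal: "\<alpha> * (1 + 1) = \<alpha> + \<alpha>" for \<alpha> :: ordinal
  by (metis times_ordinal_simps(1,2) zero_plus_ordinal)

lemma two_opow_mono: "\<alpha> \<le> \<beta> \<Longrightarrow> (1 + 1) ^\<^sub>o \<alpha> \<le> (1 + 1) ^\<^sub>o \<beta>"
  unfolding opow_def
  by (rule orec_mono)
    (use plus_ordinal_mono_right[OF zero_le_ordinal] in \<open>simp_all add: times_two_ordinal plus_ordinal_simps\<close>)

lemma two_opow_osuc: "(1 + 1) ^\<^sub>o (\<alpha> + 1) = (1 + 1) ^\<^sub>o \<alpha> + (1 + 1) ^\<^sub>o \<alpha>"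
  by (simp add: opow_simps times_two_ordinal)

lemma one_le_two_opow: "1 \<le> (1 + 1) ^\<^sub>o \<alpha>"
  using two_opow_mono[OF zero_le_ordinal] by (simp add: opow_simps)

section \<open>Heights of dialogue trees\<close>

text \<open>Leaves of \<open>d\<close> turn into trees of height at most \<open>S\<close>, and each
  node above them adds a successor. Successors enter a sum from the right, so \<open>S\<close> has
  to be the left summand.\<close>

lemma height_graft_le:
  assumes "\<And>n. height (g n) \<le> S"
  shows "height (graft d g) \<le> S + height d"
proof (induction d)
  case (Leaf n)
  then show ?case using assms by (simp add: plus_ordinal_simps)
next
  case (Node i \<phi>)
  have "height (graft (\<phi> n) g) + 1 \<le> S + (SUP n. height (\<phi> n) + 1)" for n
  proof -
    have "height (graft (\<phi> n) g) + 1 \<le> S + height (\<phi> n) + 1"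
      using Node by (intro plus_ordinal_mono_left) simp
    also have "\<dots> = S + (height (\<phi> n) + 1)"
      by (simp add: plus_one_ordinal plus_ordinal_simps)
    also have "\<dots> \<le> S + (SUP n. height (\<phi> n) + 1)"
      by (intro plus_ordinal_mono_right le_SUP_ordinal[of "\<lambda>n. height (\<phi> n) + 1"])
    finally show ?thesis .
  qed
  then show ?case by (simp add: cSUP_least)
qed

section \<open>Closed normal terms\<close>

text \<open>The context is a variable fixed by an equation so that rule induction on typing
  applies.\<close>

lemma closed_normal_not_App:
  assumes "\<Gamma> \<turnstile> M \<Colon> \<tau>" and "\<Gamma> = []" and "beta_normal \<Gamma> M"
  shows "M \<noteq> App F V"
  using assms
proof (induction arbitrary: F V)
  case (App \<Gamma> F' \<sigma> \<tau> V')
  have "beta_normal \<Gamma> F'"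
    using App.prems unfolding beta_normal_def by (blast intro: subterm.fun_part)
  then have "\<And>F V. F' \<noteq> App F V"
    using App by blast
  \<comment> \<open>Variables need a nonempty context, the other non-abstractions left have type
    \<open>\<iota>\<close>, and \<open>F'\<close> has an arrow type.\<close>
  with App.hyps(1) App.prems(1) obtain U where "F' = Lam \<sigma> U"
    by (cases rule: typed.cases) auto
  then show ?case
    using App.prems(2) unfolding beta_normal_def by (blast intro: subterm.self)
qed auto

lemma height_sem_closed_normal_le:
  assumes "[] \<turnstile> N \<Colon> \<iota>" and "beta_normal [] N"
  shows "height (ground (sem code decode N [])) \<le> (1 + 1) ^\<^sub>o rank N"
  using assms
proof (induction N)
  case (Query i Ms)
  let ?R = "(1 + 1) ^\<^sub>o (SUP n. rank (Ms n))"
  have "height (ground (sem code decode (Ms n) [])) + 1 \<le> ?R + ?R" for n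
  proof -
    have "[] \<turnstile> Ms n \<Colon> \<iota>" using Query.prems(1) by (cases rule: typed.cases) auto
    moreover have "beta_normal [] (Ms n)"
      using Query.prems(2) unfolding beta_normal_def by (blast intro: subterm.query)
    ultimately have "height (ground (sem code decode (Ms n) [])) \<le> (1 + 1) ^\<^sub>o rank (Ms n)"
      using Query.IH by blast
    also have "\<dots> \<le> ?R" by (intro two_opow_mono le_SUP_ordinal[of "\<lambda>n. rank (Ms n)"])
    \<comment> \<open>With \<open>h\<close> the height of the branch,
      \<open>h + 1 \<le> ?R + 1 \<le> ?R + ?R\<close>, the last because powers of 2 are at least
      1.\<close>
    finally show ?thesis
      using plus_ordinal_mono_left plus_ordinal_mono_right[OF one_le_two_opow] order_trans by blast
  qed
  then show ?case by (simp add: two_opow_osuc cSUP_least)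
next
  case (Case M Ms)
  let ?R = "(1 + 1) ^\<^sub>o max (rank M) (SUP n. rank (Ms n))"
  have typed: "[] \<turnstile> M \<Colon> \<iota>" "[] \<turnstile> Ms n \<Colon> \<iota>" for n
    using Case.prems(1) by (cases rule: typed.cases; simp)+
  have normal: "beta_normal [] M" "beta_normal [] (Ms n)" for n
    using Case.prems(2) unfolding beta_normal_def by (blast intro: subterm.scrutinee subterm.branch)+
  have "height (ground (sem code decode M [])) \<le> ?R"
    using Case.IH(1) typed normal two_opow_mono[OF max.cobounded1] order_trans by blast
  moreover have "height (ground (sem code decode (Ms n) [])) \<le> ?R" for n
  proof -
    have "height (ground (sem code decode (Ms n) [])) \<le> (1 + 1) ^\<^sub>o rank (Ms n)"
      using Case.IH(2) typed normal by blast
    also have "\<dots> \<le> ?R"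
      by (intro two_opow_mono max.coboundedI2 le_SUP_ordinal[of "\<lambda>n. rank (Ms n)"])
    finally show ?thesis .
  qed
  \<comment> \<open>The grafting bound with \<open>S = ?R\<close>; the scrutinee contributes the
    second \<open>?R\<close>.\<close>
  ultimately have "height (graft (ground (sem code decode M []))
      (\<lambda>n. ground (sem code decode (Ms n) []))) \<le> ?R + ?R"
    using height_graft_le plus_ordinal_mono_right order_trans by meson
  then show ?case by (simp add: two_opow_osuc)
next
  case (Var n)
  then show ?case by (auto elim: typed.cases)
next
  case (Lam \<sigma> M)
  from Lam.prems(1) show ?case by (cases rule: typed.cases)
next
  case (App F V)
  then show ?case using closed_normal_not_App by blast
qed simp

theorem lemma12:
  fixes N :: trm
    and code :: "'u graph \<Rightarrow> 'u" and decode :: "'u \<Rightarrow> 'u graph"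
  assumes "full_hierarchy code decode (types_in [] N)"
    and "[] \<turnstile> N \<Colon> \<iota>"
    and "beta_normal [] N"
  shows "height (ground (sem code decode N [])) \<le> (1 + 1) ^\<^sub>o rank N"
  using assms(2,3) by (rule height_sem_closed_normal_le)

end
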